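(* Let $k$ be a field, $V$ a finite-dimensional $k$-vector space and $b:V\times V\to k$ an anisotropic symmetric $k$-bilinear form. Then $\varphi\mapsto\varphi^{-1}V[t^{-1}]$ establishes an isomorphism of posets between - $\mathrm{PPU}(b)$ with the right-divisibility order given by $\mathrm{PPU}(b)^-$ (that is, $\varphi$ is below $\psi$ iff $\psi\varphi^{-1}\in\mathrm{PPU}(b)^-$), and - the set of finitely generated $k[t^{-1}]$-submodules $U\subseteq V[t,t^{-1}]$ that contain $t^mV[t^{-1}]$ for some $m\in\mathbb Z$, ordered by inclusion.
   Context: Anisotropic means $b(v,v)=0\Leftrightarrow v=0$. Let $V[t,t^{-1}]:=k[t,t^{-1}]\otimes_k V$; its elements are finite sums $v=\sum_{i\in\mathbb Z}t^iv_i$ with $v_i\in V$; $V[t^{-1}]:=k[t^{-1}]\otimes_kV\subseteq V[t,t^{-1}]$. Define $\tilde b(v,w)=\sum_{n\in\mathbb Z} t^n\big(\sum_{i\in\mathbb Z} b(v_{i-n},w_i)\big)\in k[t,t^{-1}]$. Each $\varphi\in \mathrm{End}_{k[t,t^{-1}]}V[t,t^{-1}]$ is uniquely a finite sum $\varphi=\sum_i t^i\varphi_i$ with $\varphi_i\in\mathrm{End}_kV$; put $\varphi(1)=\sum_i\varphi_i$. The paraunitary group $\mathrm{PU}(b)$ is the group of all $k[t,t^{-1}]$-linear automorphisms $\varphi$ of $V[t,t^{-1}]$ with $\tilde b(\varphi(v),\varphi(w))=\tilde b(v,w)$ for all $v,w$. The pure paraunitary group is $\mathrm{PPU}(b)=\{\varphi\in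 \mathrm{PU}(b):\varphi(1)=\mathrm{id}_V\}$, and $\mathrm{PPU}(b)^-$ is the submonoid of those $\varphi\in\mathrm{PPU}(b)$ with $\varphi_i=0$ for all $i>0$. *)

theory Defs
  imports "HOL-Library.Poly_Mapping" "HOL-Computational_Algebra.Polynomial"
begin

definition bilinear_form :: "('k::field \<Rightarrow> 'v::ab_group_add \<Rightarrow> 'v) \<Rightarrow> ('v \<Rightarrow> 'v \<Rightarrow> 'k) \<Rightarrow> bool"
  where "bilinear_form scale b \<longleftrightarrow>
    (\<forall>v. Vector_Spaces.linear scale (*) (\<lambda>w. b v w)) \<and>
    (\<forall>w. Vector_Spaces.linear scale (*) (\<lambda>v. b v w))"

definition symmetric_form :: "('v \<Rightarrow> 'v \<Rightarrow> 'k) \<Rightarrow> bool"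
  where "symmetric_form b \<longleftrightarrow> (\<forall>v w. b v w = b w v)"

definition anisotropic :: "('v::zero \<Rightarrow> 'v \<Rightarrow> 'k::zero) \<Rightarrow> bool"
  where "anisotropic b \<longleftrightarrow> (\<forall>v. b v v = 0 \<longleftrightarrow> v = 0)"

text \<open>
  The ring \<open>k[t,t\<inverse>]\<close> is the type \<open>int \<Rightarrow>\<^sub>0 'k\<close> with its convolution product, and
  \<open>V[t,t\<inverse>]\<close> is the type \<open>int \<Rightarrow>\<^sub>0 'v\<close>: the sum of the \<open>t\<^sup>i v\<^sub>i\<close> is the mapping
  \<open>i \<mapsto> v\<^sub>i\<close>, and \<open>t\<^sup>i v\<close> is \<open>single i v\<close>.
\<close>

type_synonym 'a laurent = "int \<Rightarrow>\<^sub>0 'a"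

definition laurent_scale ::
    "('k::field \<Rightarrow> 'v::ab_group_add \<Rightarrow> 'v) \<Rightarrow> 'k laurent \<Rightarrow> 'v laurent \<Rightarrow> 'v laurent"
  where "laurent_scale scale p v =
    (\<Sum>i\<in>Poly_Mapping.keys p. \<Sum>j\<in>Poly_Mapping.keys v.
      Poly_Mapping.single (i + j) (scale (Poly_Mapping.lookup p i) (Poly_Mapping.lookup v j)))"

definition t_power :: "int \<Rightarrow> 'k::field laurent"
  where "t_power m = Poly_Mapping.single m 1"

text \<open>
  The ring \<open>k[t\<inverse>]\<close> is the type \<open>'k poly\<close>, embedded into \<open>k[t,t\<inverse>]\<close> by substituting
  \<open>t\<inverse>\<close> for the variable.
\<close>

definition laurent_of_poly :: "'k::field poly \<Rightarrow> 'k laurent"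
  where "laurent_of_poly p = poly (map_poly (Poly_Mapping.single 0) p) (t_power (- 1))"

definition tinv_scale ::
    "('k::field \<Rightarrow> 'v::ab_group_add \<Rightarrow> 'v) \<Rightarrow> 'k poly \<Rightarrow> 'v laurent \<Rightarrow> 'v laurent"
  where "tinv_scale scale p v = laurent_scale scale (laurent_of_poly p) v"

definition V_tinv :: "'v::zero laurent set"
  where "V_tinv = {v. \<forall>i>0. Poly_Mapping.lookup v i = 0}"

definition laurent_form ::
    "('v::zero \<Rightarrow> 'v \<Rightarrow> 'k::field) \<Rightarrow> 'v laurent \<Rightarrow> 'v laurent \<Rightarrow> 'k laurent"
  where "laurent_form b v w =
    Poly_Mapping.Abs_poly_mapping
      (\<lambda>n. Sum_any (\<lambda>i. b (Poly_Mapping.lookup v (i - n)) (Poly_Mapping.lookup w i)))"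

definition laurent_endo ::
    "('k::field \<Rightarrow> 'v::ab_group_add \<Rightarrow> 'v) \<Rightarrow> ('v laurent \<Rightarrow> 'v laurent) \<Rightarrow> bool"
  where "laurent_endo scale \<phi> \<longleftrightarrow> module_hom (laurent_scale scale) (laurent_scale scale) \<phi>"

text \<open>
  The component \<open>\<phi>\<^sub>i\<close> in \<open>End(V)\<close> sends \<open>v\<close> to the coefficient of \<open>t\<^sup>i\<close> in \<open>\<phi>(v)\<close>;
  see \<open>laurent_endo_expansion\<close> and \<open>laurent_endo_expansion_unique\<close> below.
\<close>

definition endo_coeff :: "('v::ab_group_add laurent \<Rightarrow> 'v laurent) \<Rightarrow> int \<Rightarrow> 'v \<Rightarrow> 'v"
  where "endo_coeff \<phi> i v = Poly_Mapping.lookup (\<phi> (Poly_Mapping.single 0 v)) i"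

definition endo_at_one :: "('v::ab_group_add laurent \<Rightarrow> 'v laurent) \<Rightarrow> 'v \<Rightarrow> 'v"
  where "endo_at_one \<phi> v = Sum_any (\<lambda>i. endo_coeff \<phi> i v)"

definition PU ::
    "('k::field \<Rightarrow> 'v::ab_group_add \<Rightarrow> 'v) \<Rightarrow> ('v \<Rightarrow> 'v \<Rightarrow> 'k) \<Rightarrow> ('v laurent \<Rightarrow> 'v laurent) set"
  where "PU scale b =
    {\<phi>. laurent_endo scale \<phi> \<and> bij \<phi> \<and>
        (\<forall>v w. laurent_form b (\<phi> v) (\<phi> w) = laurent_form b v w)}"

definition PPU ::
    "('k::field \<Rightarrow> 'v::ab_group_add \<Rightarrow> 'v) \<Rightarrow> ('v \<Rightarrow> 'v \<Rightarrow> 'k) \<Rightarrow> ('v laurent \<Rightarrow> 'v laurent) set"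
  where "PPU scale b = {\<phi> \<in> PU scale b. endo_at_one \<phi> = id}"

definition PPU_neg ::
    "('k::field \<Rightarrow> 'v::ab_group_add \<Rightarrow> 'v) \<Rightarrow> ('v \<Rightarrow> 'v \<Rightarrow> 'k) \<Rightarrow> ('v laurent \<Rightarrow> 'v laurent) set"
  where "PPU_neg scale b = {\<phi> \<in> PPU scale b. \<forall>i>0. endo_coeff \<phi> i = (\<lambda>_. 0)}"

definition right_div_le ::
    "('k::field \<Rightarrow> 'v::ab_group_add \<Rightarrow> 'v) \<Rightarrow> ('v \<Rightarrow> 'v \<Rightarrow> 'k) \<Rightarrow>
      ('v laurent \<Rightarrow> 'v laurent) \<Rightarrow> ('v laurent \<Rightarrow> 'v laurent) \<Rightarrow> bool"
  where "right_div_le scale b \<phi> \<psi> \<longleftrightarrow> \<psi> \<circ> inv \<phi> \<in> PPU_neg scale b"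

definition tinv_lattices ::
    "('k::field \<Rightarrow> 'v::ab_group_add \<Rightarrow> 'v) \<Rightarrow> 'v laurent set set"
  where "tinv_lattices scale =
    {U. module.subspace (tinv_scale scale) U \<and>
        (\<exists>F. finite F \<and> U = module.span (tinv_scale scale) F) \<and>
        (\<exists>m. laurent_scale scale (t_power m) ` V_tinv \<subseteq> U)}"

definition poset_on :: "'a set \<Rightarrow> ('a \<Rightarrow> 'a \<Rightarrow> bool) \<Rightarrow> bool"
  where "poset_on A le \<longleftrightarrow> reflp_on A le \<and> transp_on A le \<and> antisymp_on A le"

definition poset_iso ::
    "'a set \<Rightarrow> ('a \<Rightarrow> 'a \<Rightarrow> bool) \<Rightarrow> 'b set \<Rightarrow> ('b \<Rightarrow> 'b \<Rightarrow> bool) \<Rightarrow> ('a \<Rightarrow> 'b) \<Rightarrow> bool"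
  where "poset_iso A leA B leB f \<longleftrightarrow>
    poset_on A leA \<and> poset_on B leB \<and> bij_betw f A B \<and>
    (\<forall>x\<in>A. \<forall>y\<in>A. leA x y \<longleftrightarrow> leB (f x) (f y))"

lemma laurent_expand: "(\<Sum>j\<in>Poly_Mapping.keys v. Poly_Mapping.single j (Poly_Mapping.lookup v j)) = v"
  by (rule poly_mapping_eqI)
     (simp add: lookup_sum lookup_single when_def in_keys_iff)

lemma laurent_induct [case_names zero single add]:
  assumes "P 0" "\<And>i a. P (Poly_Mapping.single i a)" "\<And>p q. P p \<Longrightarrow> P q \<Longrightarrow> P (p + q)"
  shows "P (p :: 'a::comm_monoid_add laurent)"
proof -
  have "P (\<Sum>j\<in>A. Poly_Mapping.single j (Poly_Mapping.lookup p j))" if "finite A" for A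
    using that by (induction A) (auto intro: assms)
  from this[of "Poly_Mapping.keys p"] show ?thesis by (simp add: laurent_expand)
qed

lemma lookup_laurent_form:
  assumes b0: "\<And>w. b 0 w = 0" "\<And>v. b v 0 = 0"
  shows "Poly_Mapping.lookup (laurent_form b v w) n =
    (\<Sum>i\<in>Poly_Mapping.keys w. b (Poly_Mapping.lookup v (i - n)) (Poly_Mapping.lookup w i))"
proof -
  have eq: "Sum_any (\<lambda>i. b (Poly_Mapping.lookup v (i - n)) (Poly_Mapping.lookup w i)) =
      (\<Sum>i\<in>Poly_Mapping.keys w. b (Poly_Mapping.lookup v (i - n)) (Poly_Mapping.lookup w i))" for n
    by (rule Sum_any.expand_superset) (auto simp: in_keys_iff b0)
  have "{n. (\<Sum>i\<in>Poly_Mapping.keys w. b (Poly_Mapping.lookup v (i - n)) (Poly_Mapping.lookup w i)) \<noteq> 0}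
      \<subseteq> (\<lambda>(i, j). i - j) ` (Poly_Mapping.keys w \<times> Poly_Mapping.keys v)"
  proof
    fix n
    assume "n \<in> {n. (\<Sum>i\<in>Poly_Mapping.keys w. b (Poly_Mapping.lookup v (i - n)) (Poly_Mapping.lookup w i)) \<noteq> 0}"
    then obtain i where i: "i \<in> Poly_Mapping.keys w"
      "b (Poly_Mapping.lookup v (i - n)) (Poly_Mapping.lookup w i) \<noteq> 0"
      by (auto elim: sum.not_neutral_contains_not_neutral)
    then have "i - n \<in> Poly_Mapping.keys v" by (auto simp: in_keys_iff b0)
    with i show "n \<in> (\<lambda>(i, j). i - j) ` (Poly_Mapping.keys w \<times> Poly_Mapping.keys v)"
      by (force intro: image_eqI[of _ _ "(i, i - n)"])
  qed
  then have "finite {n. (\<Sum>i\<in>Poly_Mapping.keys w. b (Poly_Mapping.lookup v (i - n)) (Poly_Mapping.lookup w i)) \<noteq> 0}"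
    by (rule finite_subset) auto
  then show ?thesis by (simp add: laurent_form_def eq Abs_poly_mapping_inverse)
qed

lemma laurent_of_poly_pCons:
  "laurent_of_poly (pCons a p) = Poly_Mapping.single 0 a + t_power (- 1) * laurent_of_poly p"
  by (cases "pCons a p = 0") (auto simp: laurent_of_poly_def map_poly_pCons)

lemma laurent_of_poly_0 [simp]: "laurent_of_poly 0 = 0"
  by (simp add: laurent_of_poly_def)

lemma laurent_of_poly_1 [simp]: "laurent_of_poly 1 = 1"
  by (simp add: one_pCons laurent_of_poly_pCons)

lemma laurent_of_poly_add: "laurent_of_poly (p + q) = laurent_of_poly p + laurent_of_poly q"
  by (induction p q rule: poly_induct2)
     (simp_all add: laurent_of_poly_pCons single_add algebra_simps)

lemma laurent_of_poly_smult:
  "laurent_of_poly (smult c p) = Poly_Mapping.single 0 c * laurent_of_poly p"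
  by (induction p) (simp_all add: laurent_of_poly_pCons mult_single algebra_simps)

lemma laurent_of_poly_mult: "laurent_of_poly (p * q) = laurent_of_poly p * laurent_of_poly q"
  by (induction p)
     (simp_all add: laurent_of_poly_pCons laurent_of_poly_add laurent_of_poly_smult algebra_simps)

lemma lookup_laurent_of_poly:
  "Poly_Mapping.lookup (laurent_of_poly p) n = (if n \<le> 0 then coeff p (nat (- n)) else 0)"
proof (induction p arbitrary: n)
  case 0
  then show ?case by simp
next
  case (pCons a p)
  have shift: "Poly_Mapping.lookup (t_power (- 1) * q) n = Poly_Mapping.lookup q (n + 1)" for q :: "'a laurent"
    by (induction q rule: laurent_induct)
       (auto simp: t_power_def mult_single lookup_single lookup_add when_def algebra_simps)
  have "nat (- n) = Suc (nat (- (n + 1)))" if "n < 0" using that by simp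
  then show ?case
    by (auto simp: laurent_of_poly_pCons lookup_add shift pCons.IH lookup_single when_def)
qed

context vector_space
begin

lemma laurent_scale_single_left:
  "laurent_scale scale (Poly_Mapping.single i a) v =
    (\<Sum>j\<in>Poly_Mapping.keys v. Poly_Mapping.single (i + j) (scale a (Poly_Mapping.lookup v j)))"
  by (simp add: laurent_scale_def)

lemma laurent_scale_single:
  "laurent_scale scale (Poly_Mapping.single i a) (Poly_Mapping.single j x) =
    Poly_Mapping.single (i + j) (scale a x)"
  by (simp add: laurent_scale_single_left)

lemma laurent_scale_add_left:
  "laurent_scale scale (p + q) v = laurent_scale scale p v + laurent_scale scale q v"
  unfolding laurent_scale_def
  by (rule setsum_keys_plus_distrib[of
        "\<lambda>i a. \<Sum>j\<in>Poly_Mapping.keys v. Poly_Mapping.single (i + j) (scale a (Poly_Mapping.lookup v j))"])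
     (simp_all add: scale_left_distrib single_add sum.distrib)

lemma laurent_scale_add_right:
  "laurent_scale scale p (v + w) = laurent_scale scale p v + laurent_scale scale p w"
proof -
  have "(\<Sum>j\<in>Poly_Mapping.keys (v + w). Poly_Mapping.single (i + j) (scale a (Poly_Mapping.lookup (v + w) j))) =
     (\<Sum>j\<in>Poly_Mapping.keys v. Poly_Mapping.single (i + j) (scale a (Poly_Mapping.lookup v j))) +
     (\<Sum>j\<in>Poly_Mapping.keys w. Poly_Mapping.single (i + j) (scale a (Poly_Mapping.lookup w j)))" for i :: int and a
    by (rule setsum_keys_plus_distrib[of "\<lambda>j x. Poly_Mapping.single (i + j) (scale a x)"])
       (simp_all add: scale_right_distrib single_add)
  then show ?thesis by (simp add: laurent_scale_def sum.distrib)
qed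

lemma laurent_scale_zero [simp]:
  "laurent_scale scale 0 v = 0" "laurent_scale scale p 0 = 0"
  by (simp_all add: laurent_scale_def)

lemma module_laurent_scale: "module (laurent_scale scale)"
proof
  show "laurent_scale scale p (laurent_scale scale q v) = laurent_scale scale (p * q) v" for p q v
  proof (induction p rule: laurent_induct)
    case (single i a)
    show ?case
    proof (induction q rule: laurent_induct)
      case (single j c)
      show ?case
        by (induction v rule: laurent_induct)
           (simp_all add: laurent_scale_single mult_single laurent_scale_add_right add.assoc)
    qed (simp_all add: laurent_scale_add_left laurent_scale_add_right algebra_simps)
  qed (simp_all add: laurent_scale_add_left laurent_scale_add_right algebra_simps)
  show "laurent_scale scale 1 v = v" for v
    by (simp add: laurent_scale_single_left laurent_expand flip: single_one)
qed (rule laurent_scale_add_left laurent_scale_add_right)+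

lemma module_tinv_scale: "module (tinv_scale scale)"
proof -
  interpret L: module "laurent_scale scale" by (rule module_laurent_scale)
  show ?thesis
    by unfold_locales
       (simp_all add: tinv_scale_def laurent_of_poly_add laurent_of_poly_mult
          L.scale_left_distrib L.scale_right_distrib)
qed

lemma linear_endo_coeff:
  assumes "laurent_endo scale \<phi>"
  shows "Vector_Spaces.linear scale scale (endo_coeff \<phi> i)"
proof -
  interpret module_hom "laurent_scale scale" "laurent_scale scale" \<phi>
    using assms by (simp add: laurent_endo_def)
  have lookup0: "Poly_Mapping.lookup (laurent_scale scale (Poly_Mapping.single 0 c) v) i =
      scale c (Poly_Mapping.lookup v i)" for c v
    by (induction v rule: laurent_induct)
       (auto simp: laurent_scale_single laurent_scale_add_right lookup_add lookup_single when_def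
          scale_right_distrib)
  show ?thesis
  proof unfold_locales
    show "endo_coeff \<phi> i (x + y) = endo_coeff \<phi> i x + endo_coeff \<phi> i y" for x y
      by (simp add: endo_coeff_def single_add add lookup_add)
    show "endo_coeff \<phi> i (scale c x) = scale c (endo_coeff \<phi> i x)" for c x
      using scale[of "Poly_Mapping.single 0 c" "Poly_Mapping.single 0 x"]
      by (simp add: endo_coeff_def laurent_scale_single lookup0)
  qed
qed

end

lemma (in finite_dimensional_vector_space) laurent_endo_expansion:
  assumes "laurent_endo scale \<phi>"
  shows "finite {i. endo_coeff \<phi> i \<noteq> (\<lambda>_. 0)}"
    and "\<phi> v = (\<Sum>i | endo_coeff \<phi> i \<noteq> (\<lambda>_. 0).
      laurent_scale scale (t_power i) (Poly_Mapping.map (endo_coeff \<phi> i) v))"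
proof -
  interpret h: module_hom "laurent_scale scale" "laurent_scale scale" \<phi>
    using assms by (simp add: laurent_endo_def)
  let ?I = "{i. endo_coeff \<phi> i \<noteq> (\<lambda>_. 0)}"
  have "?I \<subseteq> (\<Union>e\<in>Basis. Poly_Mapping.keys (\<phi> (Poly_Mapping.single 0 e)))"
  proof
    fix i assume i: "i \<in> ?I"
    interpret l: Vector_Spaces.linear scale scale "endo_coeff \<phi> i"
      by (rule linear_endo_coeff[OF assms])
    show "i \<in> (\<Union>e\<in>Basis. Poly_Mapping.keys (\<phi> (Poly_Mapping.single 0 e)))"
    proof (rule ccontr)
      assume "\<not> ?thesis"
      then have z: "endo_coeff \<phi> i e = 0" if "e \<in> Basis" for e
        using that by (auto simp: endo_coeff_def in_keys_iff)
      have "endo_coeff \<phi> i x = 0" for x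
      proof (rule l.eq_0_on_span)
        show "x \<in> span Basis" by (simp add: span_Basis)
      qed (use z in auto)
      with i show False by auto
    qed
  qed
  then show fin: "finite ?I" by (rule finite_subset) (auto simp: finite_Basis)
  have c0: "endo_coeff \<phi> i 0 = 0" for i
    by (simp add: endo_coeff_def h.zero)
  have cadd: "endo_coeff \<phi> i (x + y) = endo_coeff \<phi> i x + endo_coeff \<phi> i y" for i x y
    by (simp add: endo_coeff_def single_add h.add lookup_add)
  have lookup_map: "Poly_Mapping.lookup (Poly_Mapping.map (endo_coeff \<phi> i) v) k =
      endo_coeff \<phi> i (Poly_Mapping.lookup v k)" for i v k
    by (simp add: map.rep_eq when_def c0)
  have map_add: "Poly_Mapping.map (endo_coeff \<phi> i) (v + w) =
      Poly_Mapping.map (endo_coeff \<phi> i) v + Poly_Mapping.map (endo_coeff \<phi> i) w" for i v w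
    by (rule poly_mapping_eqI) (simp add: lookup_map lookup_add cadd)
  show "\<phi> v = (\<Sum>i\<in>?I. laurent_scale scale (t_power i) (Poly_Mapping.map (endo_coeff \<phi> i) v))"
  proof (induction v rule: laurent_induct)
    case zero
    have "Poly_Mapping.map (endo_coeff \<phi> i) (0 :: 'b laurent) = 0" for i
      by (rule poly_mapping_eqI) (simp add: map.rep_eq)
    then show ?case by (simp add: h.zero)
  next
    case (single j x)
    have "\<phi> (Poly_Mapping.single j x) = laurent_scale scale (t_power j) (\<phi> (Poly_Mapping.single 0 x))"
      using h.scale[of "t_power j" "Poly_Mapping.single 0 x"]
      by (simp add: t_power_def laurent_scale_single)
    also have "\<phi> (Poly_Mapping.single 0 x) = (\<Sum>i\<in>?I. Poly_Mapping.single i (endo_coeff \<phi> i x))"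
    proof (rule poly_mapping_eqI)
      fix k
      have "Poly_Mapping.lookup (\<phi> (Poly_Mapping.single 0 x)) k = endo_coeff \<phi> k x"
        by (simp add: endo_coeff_def)
      also have "\<dots> = (\<Sum>i\<in>?I. if i = k then endo_coeff \<phi> i x else 0)"
        by (subst sum.delta[OF fin]) auto
      finally show "Poly_Mapping.lookup (\<phi> (Poly_Mapping.single 0 x)) k =
          Poly_Mapping.lookup (\<Sum>i\<in>?I. Poly_Mapping.single i (endo_coeff \<phi> i x)) k"
        by (simp add: lookup_sum lookup_single when_def)
    qed
    finally show ?case
      by (simp add: h.m1.scale_sum_right t_power_def laurent_scale_single map_single c0 add.commute)
  next
    case (add p q)
    then show ?case by (simp add: h.add map_add laurent_scale_add_right sum.distrib)
  qed
qed

lemma (in vector_space) laurent_endo_expansion_unique: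
  assumes "finite I" and "\<And>i. \<psi> i 0 = 0" and "\<And>i. i \<notin> I \<Longrightarrow> \<psi> i = (\<lambda>_. 0)"
    and "\<And>v. \<phi> v = (\<Sum>i\<in>I. laurent_scale scale (t_power i) (Poly_Mapping.map (\<psi> i) v))"
  shows "\<psi> i = endo_coeff \<phi> i"
  by (rule ext)
     (use assms in \<open>auto simp: endo_coeff_def t_power_def laurent_scale_single lookup_sum lookup_single when_def map_single\<close>)

end

theory Submission
  imports Defs
begin

text \<open>
  The map is an order embedding because \<open>\<chi> = \<psi> \<circ> \<phi>\<inverse>\<close> has no positive components iff it maps
  \<open>V[t\<inverse>]\<close> into itself; if \<open>\<chi>\<inverse>\<close> has none either, then unitarity forces \<open>\<chi>\<close> to be
  constant, hence equal to \<open>\<chi>(1) = id\<close>. For surjectivity, shift \<open>U\<close> until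
  \<open>t\<^sup>-\<^sup>N V[t\<inverse>] \<subseteq> U \<subseteq> V[t\<inverse>]\<close>, and let \<open>p\<close> be the orthogonal projection onto the space
  of constant coefficients of \<open>U\<close>. The paraunitary map \<open>p + t (1 - p)\<close> moves \<open>U\<close> to a module
  between \<open>t\<^sup>1\<^sup>-\<^sup>N V[t\<inverse>]\<close> and \<open>V[t\<inverse>]\<close>, so that induction on \<open>N\<close> applies.
\<close>

definition lat :: "int \<Rightarrow> 'v::zero laurent set"
  where "lat n = {v. \<forall>i>n. Poly_Mapping.lookup v i = 0}"

definition eval_one :: "'v::comm_monoid_add laurent \<Rightarrow> 'v"
  where "eval_one v = Sum_any (Poly_Mapping.lookup v)"

lemma V_tinv_eq_lat: "V_tinv = lat 0"
  by (simp add: V_tinv_def lat_def)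

lemma eval_one_add: "eval_one (v + w) = eval_one v + eval_one w"
  unfolding eval_one_def lookup_add by (rule Sum_any.distrib) auto

lemma eval_one_single [simp]: "eval_one (Poly_Mapping.single i x) = x"
  by (simp add: eval_one_def lookup_single when_def)

lemma endo_at_one_eq: "endo_at_one \<phi> v = eval_one (\<phi> (Poly_Mapping.single 0 v))"
  by (simp add: endo_at_one_def eval_one_def endo_coeff_def)

definition twist ::
    "('k::field \<Rightarrow> 'v::ab_group_add \<Rightarrow> 'v) \<Rightarrow> ('v \<Rightarrow> 'v) \<Rightarrow> int \<Rightarrow> 'v laurent \<Rightarrow> 'v laurent"
  where "twist scale p e v =
    Poly_Mapping.map p v + laurent_scale scale (t_power e) (Poly_Mapping.map (\<lambda>x. x - p x) v)"

lemma finite_subset_lat: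
  assumes "finite F"
  shows "\<exists>n. F \<subseteq> lat n"
proof -
  have "finite (\<Union>v\<in>F. Poly_Mapping.keys v)" using assms by simp
  then obtain n where n: "\<And>i. i \<in> (\<Union>v\<in>F. Poly_Mapping.keys v) \<Longrightarrow> i \<le> n"
    by (meson bdd_above_finite bdd_above.E)
  show ?thesis
  proof (intro exI subsetI)
    fix v assume "v \<in> F"
    with n show "v \<in> lat n" unfolding lat_def by (force simp: in_keys_iff)
  qed
qed

context vector_space
begin

lemma lookup_laurent_scale_single:
  "Poly_Mapping.lookup (laurent_scale scale (Poly_Mapping.single i a) v) n =
    scale a (Poly_Mapping.lookup v (n - i))"
  by (induction v rule: laurent_induct)
     (auto simp: laurent_scale_single laurent_scale_add_right lookup_add lookup_single when_def
        scale_right_distrib)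

lemma laurent_endoI:
  assumes "\<And>v w. \<phi> (v + w) = \<phi> v + \<phi> w"
    and "\<And>i a v. \<phi> (laurent_scale scale (Poly_Mapping.single i a) v) =
      laurent_scale scale (Poly_Mapping.single i a) (\<phi> v)"
  shows "laurent_endo scale \<phi>"
proof -
  interpret L: module "laurent_scale scale" by (rule module_laurent_scale)
  have "\<phi> (0 + 0) = \<phi> 0 + \<phi> 0" by (rule assms)
  then have 0: "\<phi> 0 = 0" by simp
  have "\<phi> (laurent_scale scale q v) = laurent_scale scale q (\<phi> v)" for q v
    by (induction q rule: laurent_induct) (simp_all add: 0 assms laurent_scale_add_left)
  then show ?thesis
    unfolding laurent_endo_def by unfold_locales (simp_all add: assms)
qed

lemma laurent_endo_single:
  assumes "laurent_endo scale \<phi>"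
  shows "\<phi> (Poly_Mapping.single j x) = laurent_scale scale (t_power j) (\<phi> (Poly_Mapping.single 0 x))"
proof -
  interpret h: module_hom "laurent_scale scale" "laurent_scale scale" \<phi>
    using assms by (simp add: laurent_endo_def)
  show ?thesis
    using h.scale[of "t_power j" "Poly_Mapping.single 0 x"]
    by (simp add: t_power_def laurent_scale_single)
qed

lemma lookup_t_power_scale:
  "Poly_Mapping.lookup (laurent_scale scale (t_power i) v) n = Poly_Mapping.lookup v (n - i)"
  by (simp add: t_power_def lookup_laurent_scale_single)

lemma eval_one_t_power_scale: "eval_one (laurent_scale scale (t_power j) v) = eval_one v"
  by (induction v rule: laurent_induct)
     (simp_all add: laurent_scale_add_right eval_one_add t_power_def laurent_scale_single)

lemma eval_one_endo:
  assumes "laurent_endo scale \<phi>"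
  shows "eval_one (\<phi> v) = endo_at_one \<phi> (eval_one v)"
proof -
  interpret h: module_hom "laurent_scale scale" "laurent_scale scale" \<phi>
    using assms by (simp add: laurent_endo_def)
  show ?thesis
  proof (induction v rule: laurent_induct)
    case zero
    have "eval_one (0::'b laurent) = 0" by (simp add: eval_one_def)
    then show ?case by (simp add: h.zero endo_at_one_eq)
  next
    case (single i a)
    then show ?case
      by (simp add: laurent_endo_single[OF assms, of i] eval_one_t_power_scale endo_at_one_eq)
  next
    case (add p q)
    then show ?case
      by (simp add: h.add eval_one_add endo_at_one_eq single_add)
  qed
qed

lemma t_power_scale_lat: "laurent_scale scale (t_power m) ` lat n = lat (m + n)"
proof (intro equalityI subsetI)
  fix v :: "'b laurent" assume v: "v \<in> lat (m + n)"
  have "v = laurent_scale scale (t_power m) (laurent_scale scale (t_power (- m)) v)"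
    by (rule poly_mapping_eqI) (simp add: lookup_t_power_scale)
  moreover have "laurent_scale scale (t_power (- m)) v \<in> lat n"
    using v by (simp add: lat_def lookup_t_power_scale)
  ultimately show "v \<in> laurent_scale scale (t_power m) ` lat n" by blast
qed (auto simp: lat_def lookup_t_power_scale)

lemma tinv_scale_pCons:
  "tinv_scale scale (pCons a q) v =
    laurent_scale scale (Poly_Mapping.single 0 a) v +
    laurent_scale scale (t_power (- 1)) (tinv_scale scale q v)"
proof -
  interpret L: module "laurent_scale scale" by (rule module_laurent_scale)
  show ?thesis
    by (simp add: tinv_scale_def laurent_of_poly_pCons L.scale_left_distrib)
qed

lemma laurent_of_poly_monom: "laurent_of_poly (monom a n) = Poly_Mapping.single (- int n) a"
  by (rule poly_mapping_eqI) (auto simp: lookup_laurent_of_poly lookup_single when_def)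

lemma tinv_subspace_single_scale:
  assumes "module.subspace (tinv_scale scale) U" "v \<in> U"
  shows "laurent_scale scale (Poly_Mapping.single (- int n) a) v \<in> U"
  using module.subspace_scale[OF module_tinv_scale assms, of "monom a n"]
  by (simp add: tinv_scale_def laurent_of_poly_monom)

lemma tinv_subspace_lat: "module.subspace (tinv_scale scale) (lat n)"
proof (rule module.subspaceI[OF module_tinv_scale])
  show "0 \<in> lat n" by (simp add: lat_def)
  show "x + y \<in> lat n" if "x \<in> lat n" "y \<in> lat n" for x y :: "'b laurent"
    using that by (simp add: lat_def lookup_add)
  show "tinv_scale scale c x \<in> lat n" if "x \<in> lat n" for c x
    using that
  proof (induction c)
    case 0
    then show ?case by (simp add: tinv_scale_def lat_def)
  next
    case (pCons a q)
    then show ?case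
      by (auto simp: tinv_scale_pCons lat_def lookup_add lookup_laurent_scale_single
          lookup_t_power_scale)
  qed
qed

lemma laurent_endo_tinv_hom:
  assumes "laurent_endo scale \<phi>"
  shows "module_hom (tinv_scale scale) (tinv_scale scale) \<phi>"
proof -
  interpret h: module_hom "laurent_scale scale" "laurent_scale scale" \<phi>
    using assms by (simp add: laurent_endo_def)
  interpret M: module "tinv_scale scale" by (rule module_tinv_scale)
  show ?thesis by unfold_locales (simp_all add: tinv_scale_def h.add h.scale)
qed

lemma lookup_twist:
  assumes "p 0 = 0"
  shows "Poly_Mapping.lookup (twist scale p e v) n =
    p (Poly_Mapping.lookup v n) +
      (Poly_Mapping.lookup v (n - e) - p (Poly_Mapping.lookup v (n - e)))"
  using assms by (simp add: twist_def lookup_add lookup_t_power_scale map.rep_eq when_def)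

end

context finite_dimensional_vector_space
begin

lemma lat_0_eq_span:
  "lat 0 = module.span (tinv_scale scale) (Poly_Mapping.single 0 ` Basis)"
proof -
  interpret M: module "tinv_scale scale" by (rule module_tinv_scale)
  let ?S = "M.span (Poly_Mapping.single 0 ` Basis)"
  have const: "Poly_Mapping.single 0 x \<in> ?S" for x
  proof -
    have "x \<in> span Basis" by (simp add: span_Basis)
    then show ?thesis
    proof (induction rule: span_induct_alt)
      case base
      then show ?case by (simp add: M.span_zero)
    next
      case (step c x y)
      have "tinv_scale scale [:c:] (Poly_Mapping.single 0 x) \<in> ?S"
        using step(1) by (auto intro: M.span_scale M.span_base)
      also have "tinv_scale scale [:c:] (Poly_Mapping.single 0 x) = Poly_Mapping.single 0 (scale c x)"
        by (simp add: tinv_scale_def laurent_of_poly_pCons laurent_scale_single)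
      finally show ?case
        using step(2) by (simp add: single_add M.span_add)
    qed
  qed
  have sing: "Poly_Mapping.single (- int n) x \<in> ?S" for n x
    using tinv_subspace_single_scale[OF M.subspace_span const, of n 1]
    by (simp add: laurent_scale_single)
  show ?thesis
  proof (rule antisym)
    show "lat 0 \<subseteq> ?S"
    proof
      fix v :: "'b laurent" assume v: "v \<in> lat 0"
      have "Poly_Mapping.single j (Poly_Mapping.lookup v j) \<in> ?S" for j
      proof (cases "j > 0")
        case True
        then show ?thesis using v by (simp add: lat_def M.span_zero)
      next
        case False
        then show ?thesis using sing[of "nat (- j)"] by simp
      qed
      then have "(\<Sum>j\<in>Poly_Mapping.keys v. Poly_Mapping.single j (Poly_Mapping.lookup v j)) \<in> ?S"
        by (intro M.span_sum)
      then show "v \<in> ?S" by (simp add: laurent_expand)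
    qed
    show "?S \<subseteq> lat 0"
      by (rule M.span_minimal[OF _ tinv_subspace_lat]) (auto simp: lat_def lookup_single when_def)
  qed
qed

end

locale anisotropic_space = finite_dimensional_vector_space scale Basis
  for scale :: "'k::field \<Rightarrow> 'v::ab_group_add \<Rightarrow> 'v" and Basis +
  fixes b :: "'v \<Rightarrow> 'v \<Rightarrow> 'k"
  assumes bilin: "bilinear_form scale b"
    and sym: "symmetric_form b"
    and aniso: "anisotropic b"
begin

lemma linear_b: "Vector_Spaces.linear scale (*) (b v)" "Vector_Spaces.linear scale (*) (\<lambda>v. b v w)"
  using bilin by (auto simp: bilinear_form_def)

lemma b_add_right: "b v (x + y) = b v x + b v y"
  and b_diff_right: "b v (x - y) = b v x - b v y"
  and b_scale_right: "b v (scale c x) = c * b v x"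
  and b_zero_right [simp]: "b v 0 = 0"
proof -
  interpret l: Vector_Spaces.linear scale "(*)" "b v" by (rule linear_b)
  show "b v (x + y) = b v x + b v y" "b v (x - y) = b v x - b v y"
    "b v (scale c x) = c * b v x" "b v 0 = 0"
    by (simp_all add: l.add l.diff l.scale l.zero)
qed

lemma b_commute: "b v w = b w v"
  using sym by (simp add: symmetric_form_def)

lemma b_add_left: "b (x + y) v = b x v + b y v"
  and b_diff_left: "b (x - y) v = b x v - b y v"
  and b_scale_left: "b (scale c x) v = c * b x v"
  and b_zero_left [simp]: "b 0 v = 0"
  by (simp_all add: b_commute[of _ v] b_add_right b_diff_right b_scale_right)

lemma b_self_eq_0 [simp]: "b v v = 0 \<longleftrightarrow> v = 0"
  using aniso by (simp add: anisotropic_def)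

lemma laurent_form_single:
  "laurent_form b (Poly_Mapping.single i x) (Poly_Mapping.single j y) =
    Poly_Mapping.single (j - i) (b x y)"
proof (rule poly_mapping_eqI)
  fix n
  show "Poly_Mapping.lookup (laurent_form b (Poly_Mapping.single i x) (Poly_Mapping.single j y)) n =
      Poly_Mapping.lookup (Poly_Mapping.single (j - i) (b x y)) n"
    by (cases "y = 0") (auto simp: lookup_laurent_form lookup_single when_def)
qed

lemma laurent_form_add_left: "laurent_form b (u + v) w = laurent_form b u w + laurent_form b v w"
  by (rule poly_mapping_eqI) (simp add: lookup_laurent_form lookup_add b_add_left sum.distrib)

lemma laurent_form_add_right: "laurent_form b w (u + v) = laurent_form b w u + laurent_form b w v"
proof (rule poly_mapping_eqI)
  fix n
  show "Poly_Mapping.lookup (laurent_form b w (u + v)) n =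
      Poly_Mapping.lookup (laurent_form b w u + laurent_form b w v) n"
    unfolding lookup_add[of "laurent_form b w u"] lookup_laurent_form[of b, OF b_zero_left b_zero_right]
    by (rule setsum_keys_plus_distrib[of "\<lambda>i. b (Poly_Mapping.lookup w (i - n))"])
       (simp_all add: b_add_right)
qed

lemma laurent_form_zero [simp]: "laurent_form b 0 w = 0" "laurent_form b w 0 = 0"
  by (rule poly_mapping_eqI, simp add: lookup_laurent_form)+

lemma PU_endo: "\<phi> \<in> PU scale b \<Longrightarrow> laurent_endo scale \<phi>"
  and PU_bij: "\<phi> \<in> PU scale b \<Longrightarrow> bij \<phi>"
  and PU_form: "\<phi> \<in> PU scale b \<Longrightarrow> laurent_form b (\<phi> v) (\<phi> w) = laurent_form b v w"
  by (auto simp: PU_def)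

lemma PPU_PU: "\<phi> \<in> PPU scale b \<Longrightarrow> \<phi> \<in> PU scale b"
  by (simp add: PPU_def)

lemma PPU_bij: "\<phi> \<in> PPU scale b \<Longrightarrow> bij \<phi>"
  by (simp add: PPU_PU PU_bij)

lemma PPUI:
  assumes "laurent_endo scale \<phi>" "bij \<phi>"
    and "\<And>v w. laurent_form b (\<phi> v) (\<phi> w) = laurent_form b v w"
    and "\<And>v. eval_one (\<phi> (Poly_Mapping.single 0 v)) = v"
  shows "\<phi> \<in> PPU scale b"
  using assms by (auto simp: PPU_def PU_def endo_at_one_eq)

lemma PPU_eval_one: "\<phi> \<in> PPU scale b \<Longrightarrow> eval_one (\<phi> v) = eval_one v"
  by (subst eval_one_endo) (auto simp: PPU_def PU_def)

lemma PPU_id: "id \<in> PPU scale b"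
  by (rule PPUI) (auto intro: laurent_endoI)

lemma PPU_comp:
  assumes "\<phi> \<in> PPU scale b" "\<psi> \<in> PPU scale b"
  shows "\<phi> \<circ> \<psi> \<in> PPU scale b"
proof (rule PPUI)
  show "laurent_endo scale (\<phi> \<circ> \<psi>)"
    using assms[THEN PPU_PU, THEN PU_endo] unfolding laurent_endo_def
    by (intro module_hom_compose)
  show "bij (\<phi> \<circ> \<psi>)" using assms by (intro bij_comp PPU_bij)
qed (use assms in \<open>simp_all add: PU_form PPU_PU PPU_eval_one\<close>)

lemma PPU_inv:
  assumes "\<phi> \<in> PPU scale b"
  shows "inv \<phi> \<in> PPU scale b"
proof -
  interpret h: module_hom "laurent_scale scale" "laurent_scale scale" \<phi>
    using PU_endo[OF PPU_PU[OF assms]] by (simp add: laurent_endo_def)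
  have bij: "bij \<phi>" using assms by (rule PPU_bij)
  have r: "\<phi> (inv \<phi> v) = v" for v
    using bij by (simp add: bij_is_surj surj_f_inv_f)
  have l: "inv \<phi> (\<phi> v) = v" for v
    using bij by (simp add: bij_is_inj inv_f_f)
  show ?thesis
  proof (rule PPUI)
    show "laurent_endo scale (inv \<phi>)"
    proof (rule laurent_endoI)
      show "inv \<phi> (v + w) = inv \<phi> v + inv \<phi> w" for v w
        by (metis l r h.add)
      show "inv \<phi> (laurent_scale scale (Poly_Mapping.single i a) v) =
          laurent_scale scale (Poly_Mapping.single i a) (inv \<phi> v)" for i a v
        by (metis l r h.scale)
    qed
    show "bij (inv \<phi>)" using bij by (rule bij_imp_bij_inv)
    show "laurent_form b (inv \<phi> v) (inv \<phi> w) = laurent_form b v w" for v w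
      using PU_form[OF PPU_PU[OF assms], of "inv \<phi> v" "inv \<phi> w"] by (simp add: r)
    show "eval_one (inv \<phi> (Poly_Mapping.single 0 v)) = v" for v
      using PPU_eval_one[OF assms, of "inv \<phi> (Poly_Mapping.single 0 v)"] by (simp add: r)
  qed
qed

lemma PPU_neg_iff:
  assumes "\<phi> \<in> PPU scale b"
  shows "\<phi> \<in> PPU_neg scale b \<longleftrightarrow> \<phi> ` lat 0 \<subseteq> lat 0"
proof
  assume "\<phi> ` lat 0 \<subseteq> lat 0"
  moreover have "Poly_Mapping.single 0 x \<in> lat 0" for x :: 'v
    by (simp add: lat_def lookup_single)
  ultimately have "\<phi> (Poly_Mapping.single 0 x) \<in> lat 0" for x
    by blast
  then show "\<phi> \<in> PPU_neg scale b"
    using assms by (auto simp: PPU_neg_def lat_def endo_coeff_def)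
next
  assume neg: "\<phi> \<in> PPU_neg scale b"
  interpret M: module_hom "tinv_scale scale" "tinv_scale scale" \<phi>
    by (rule laurent_endo_tinv_hom[OF PU_endo[OF PPU_PU[OF assms]]])
  have "endo_coeff \<phi> i x = 0" if "i > 0" for i x
    using neg that by (simp add: PPU_neg_def)
  then have "\<phi> ` Poly_Mapping.single 0 ` Basis \<subseteq> lat 0"
    by (auto simp: lat_def endo_coeff_def)
  then have "M.m1.span (\<phi> ` Poly_Mapping.single 0 ` Basis) \<subseteq> lat 0"
    by (intro M.m1.span_minimal tinv_subspace_lat)
  then show "\<phi> ` lat 0 \<subseteq> lat 0"
    by (simp add: lat_0_eq_span M.span_image)
qed

lemma PPU_stabilizer_trivial:
  assumes "\<phi> \<in> PPU scale b" "\<phi> ` lat 0 = lat 0"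
  shows "\<phi> = id"
proof -
  have bij: "bij \<phi>" using assms(1) by (rule PPU_bij)
  have "inv \<phi> ` lat 0 = lat 0"
    using assms(2) bij by (metis bij_is_inj image_inv_f_f)
  have lat: "Poly_Mapping.single 0 x \<in> lat 0" for x :: 'v
    by (simp add: lat_def lookup_single)
  have coeff: "Poly_Mapping.lookup (\<phi> (Poly_Mapping.single 0 x)) i = 0" if "i \<noteq> 0" for x i
  proof (cases "i > 0")
    case True
    then show ?thesis using assms(2) lat[of x] by (auto simp: lat_def)
  next
    case False
    define y where "y = Poly_Mapping.lookup (\<phi> (Poly_Mapping.single 0 x)) i"
    have "inv \<phi> (Poly_Mapping.single 0 y) \<in> lat 0"
      using \<open>inv \<phi> ` lat 0 = lat 0\<close> lat by blast
    then have z: "b (Poly_Mapping.lookup (Poly_Mapping.single 0 x) (j + i))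
        (Poly_Mapping.lookup (inv \<phi> (Poly_Mapping.single 0 y)) j) = 0" for j
      using False \<open>i \<noteq> 0\<close> by (auto simp: lat_def lookup_single when_def)
    have "laurent_form b (\<phi> (Poly_Mapping.single 0 x)) (Poly_Mapping.single 0 y) =
        laurent_form b (Poly_Mapping.single 0 x) (inv \<phi> (Poly_Mapping.single 0 y))"
      using PU_form[OF PPU_PU[OF assms(1)], of _ "inv \<phi> (Poly_Mapping.single 0 y)"] bij
      by (simp add: bij_is_surj surj_f_inv_f)
    from arg_cong[OF this, of "\<lambda>f. Poly_Mapping.lookup f (- i)"]
    have "b y y = 0"
      by (cases "y = 0") (simp_all add: lookup_laurent_form z flip: y_def)
    then show ?thesis by (simp add: y_def)
  qed
  have single: "\<phi> (Poly_Mapping.single 0 x) = Poly_Mapping.single 0 x" for x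
  proof -
    define y where "y = Poly_Mapping.lookup (\<phi> (Poly_Mapping.single 0 x)) 0"
    have "\<phi> (Poly_Mapping.single 0 x) = Poly_Mapping.single 0 y"
      by (rule poly_mapping_eqI) (auto simp: lookup_single when_def coeff y_def)
    moreover from this have "y = x"
      using PPU_eval_one[OF assms(1), of "Poly_Mapping.single 0 x"] by simp
    ultimately show ?thesis by simp
  qed
  interpret h: module_hom "laurent_scale scale" "laurent_scale scale" \<phi>
    using PU_endo[OF PPU_PU[OF assms(1)]] by (simp add: laurent_endo_def)
  have "\<phi> v = v" for v
  proof (induction v rule: laurent_induct)
    case (single i a)
    then show ?case
      using laurent_endo_single[OF PU_endo[OF PPU_PU[OF assms(1)]], of i a] single
      by (simp add: t_power_def laurent_scale_single \<open>\<And>x. \<phi> (Poly_Mapping.single 0 x) = _ x\<close>)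
  qed (simp_all add: h.zero h.add)
  then show ?thesis by auto
qed

definition orth_proj :: "('v \<Rightarrow> 'v) \<Rightarrow> bool"
  where "orth_proj p \<longleftrightarrow> Vector_Spaces.linear scale scale p \<and> (\<forall>x. p (p x) = p x) \<and>
    (\<forall>x y. b (p x) (y - p y) = 0)"

lemma orth_decomp_span:
  assumes "finite S"
  shows "\<exists>p\<in>span S. \<forall>a\<in>span S. b (v - p) a = 0"
  using assms
proof (induction S arbitrary: v)
  case empty
  then show ?case by auto
next
  case (insert s S)
  obtain q where q: "q \<in> span S" "\<And>a. a \<in> span S \<Longrightarrow> b (s - q) a = 0"
    using insert.IH by blast
  obtain p where p: "p \<in> span S" "\<And>a. a \<in> span S \<Longrightarrow> b (v - p) a = 0"
    using insert.IH by blast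
  \<comment> \<open>The junk value \<open>x / 0 = 0\<close> covers the case \<open>s = q\<close>.\<close>
  define c where "c = b (v - p) (s - q) / b (s - q) (s - q)"
  have c: "c * b (s - q) (s - q) = b (v - p) (s - q)"
    by (cases "s = q") (simp_all add: c_def)
  have sub: "span S \<subseteq> span (insert s S)" by (rule span_mono) auto
  show ?case
  proof (intro bexI ballI)
    show "p + scale c (s - q) \<in> span (insert s S)"
    proof (intro span_add span_scale span_diff)
      show "p \<in> span (insert s S)" "q \<in> span (insert s S)" using p(1) q(1) sub by auto
    qed (simp add: span_base)
  next
    fix a assume "a \<in> span (insert s S)"
    then obtain k where k: "a - scale k s \<in> span S" by (auto simp: span_insert)
    define a' where "a' = a - scale k s + scale k q"
    have a': "a' \<in> span S" unfolding a'_def using k q(1) by (intro span_add span_scale)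
    have a: "a = a' + scale k (s - q)"
      by (simp add: a'_def scale_right_diff_distrib)
    have b_a: "b z a = b z a' + k * b z (s - q)" for z
      by (simp only: a b_add_right b_scale_right)
    have "b (v - (p + scale c (s - q))) a = b (v - p) a - c * b (s - q) a"
      by (simp add: diff_diff_eq[symmetric] b_diff_left[of "v - p"] b_scale_left)
    also have "\<dots> = k * (b (v - p) (s - q) - c * b (s - q) (s - q))"
      using p(2)[OF a'] q(2)[OF a'] by (simp add: b_a right_diff_distrib mult.left_commute)
    finally show "b (v - (p + scale c (s - q))) a = 0" by (simp add: c)
  qed
qed

lemma orth_decomp:
  assumes "subspace A"
  shows "\<exists>p\<in>A. \<forall>a\<in>A. b (v - p) a = 0"
proof -
  obtain B where B: "B \<subseteq> A" "independent B" "A \<subseteq> span B"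
    using maximal_independent_subset[of A] by blast
  have "span B = A" using B assms by (metis span_minimal subset_antisym)
  then show ?thesis using orth_decomp_span[OF finiteI_independent[OF B(2)], of v] by simp
qed

lemma obtain_orth_proj:
  assumes "subspace A"
  obtains p where "orth_proj p" "\<And>x. p x \<in> A" "\<And>x. x \<in> A \<Longrightarrow> p x = x"
proof -
  obtain p where p: "p v \<in> A" "\<And>a. a \<in> A \<Longrightarrow> b (v - p v) a = 0" for v
    using orth_decomp[OF assms] by metis
  have uniq: "p v = q" if "q \<in> A" "\<And>a. a \<in> A \<Longrightarrow> b (v - q) a = 0" for v q
  proof -
    have d: "p v - q \<in> A" using that(1) p(1) assms by (intro subspace_diff)
    have "p v - q = (v - q) - (v - p v)" by simp
    then have "b (p v - q) (p v - q) = b (v - q) (p v - q) - b (v - p v) (p v - q)"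
      by (metis b_diff_left)
    then show ?thesis using that(2)[OF d] p(2)[OF d] by simp
  qed
  have fix_A: "p x = x" if "x \<in> A" for x by (rule uniq) (use that in auto)
  have "p (x + y) = p x + p y" for x y
  proof (rule uniq)
    fix a assume "a \<in> A"
    have eq: "x + y - (p x + p y) = (x - p x) + (y - p y)" by simp
    show "b (x + y - (p x + p y)) a = 0"
      unfolding eq b_add_left using p(2)[OF \<open>a \<in> A\<close>] by simp
  qed (intro subspace_add assms p(1))
  moreover have "p (scale c x) = scale c (p x)" for c x
  proof (rule uniq)
    fix a assume "a \<in> A"
    then show "b (scale c x - scale c (p x)) a = 0"
      using p(2) by (simp add: b_scale_left flip: scale_right_diff_distrib)
  qed (intro subspace_scale assms p(1))
  ultimately have "Vector_Spaces.linear scale scale p" by unfold_locales auto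
  then have "orth_proj p"
    unfolding orth_proj_def using p fix_A by (auto simp: b_commute[of "p _"])
  then show thesis using that p(1) fix_A by blast
qed

lemma orth_proj_add: "orth_proj p \<Longrightarrow> p (x + y) = p x + p y"
  and orth_proj_diff: "orth_proj p \<Longrightarrow> p (x - y) = p x - p y"
  and orth_proj_scale: "orth_proj p \<Longrightarrow> p (scale c x) = scale c (p x)"
  and orth_proj_0: "orth_proj p \<Longrightarrow> p 0 = 0"
  and orth_proj_idem: "orth_proj p \<Longrightarrow> p (p x) = p x"
  and orth_proj_orth: "orth_proj p \<Longrightarrow> b (p x) (y - p y) = 0"
proof -
  assume p: "orth_proj p"
  interpret l: Vector_Spaces.linear scale scale p using p by (simp add: orth_proj_def)
  show "p (x + y) = p x + p y" "p (x - y) = p x - p y" "p (scale c x) = scale c (p x)" "p 0 = 0"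
    by (simp_all add: l.add l.diff l.scale l.zero)
  show "p (p x) = p x" "b (p x) (y - p y) = 0" using p by (auto simp: orth_proj_def)
qed

lemma twist_inverse:
  assumes "orth_proj p"
  shows "twist scale p (- e) (twist scale p e v) = v"
  by (rule poly_mapping_eqI)
     (simp add: lookup_twist orth_proj_0[OF assms] orth_proj_add[OF assms] orth_proj_diff[OF assms]
        orth_proj_idem[OF assms])

lemma bij_twist:
  assumes "orth_proj p"
  shows "bij (twist scale p e)"
proof -
  have "twist scale p e \<circ> twist scale p (- e) = id" "twist scale p (- e) \<circ> twist scale p e = id"
    using twist_inverse[OF assms, of e] twist_inverse[OF assms, of "- e"] by auto
  then show ?thesis by (auto intro: o_bij)
qed

lemma twist_PPU:
  assumes "orth_proj p"
  shows "twist scale p e \<in> PPU scale b"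
proof (rule PPUI)
  note p_simps = orth_proj_0[OF assms] orth_proj_add[OF assms] orth_proj_scale[OF assms]
  have add: "twist scale p e (v + w) = twist scale p e v + twist scale p e w" for v w
    by (rule poly_mapping_eqI) (simp add: lookup_twist p_simps lookup_add)
  show "laurent_endo scale (twist scale p e)"
    by (rule laurent_endoI[OF add], rule poly_mapping_eqI)
       (simp add: lookup_twist p_simps lookup_laurent_scale_single scale_right_distrib
          scale_right_diff_distrib algebra_simps)
  show "bij (twist scale p e)" using assms by (rule bij_twist)
  have single: "twist scale p e (Poly_Mapping.single i x) =
      Poly_Mapping.single i (p x) + Poly_Mapping.single (i + e) (x - p x)" for i x
    by (rule poly_mapping_eqI) (auto simp: lookup_twist p_simps lookup_add lookup_single when_def)
  then show "eval_one (twist scale p e (Poly_Mapping.single 0 v)) = v" for v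
    by (simp add: eval_one_add)
  have zero: "twist scale p e 0 = 0"
    by (rule poly_mapping_eqI) (simp add: lookup_twist p_simps)
  have orth: "b (p x) (y - p y) = 0" "b (y - p y) (p x) = 0" for x y
    using orth_proj_orth[OF assms] by (simp_all add: b_commute[of _ "p x"])
  have "b (p x) (p y) + b (x - p x) (y - p y) = b (p x + (x - p x)) (p y + (y - p y))" for x y
    unfolding b_add_left b_add_right orth by simp
  then have sum: "b (p x) (p y) + b (x - p x) (y - p y) = b x y" for x y by simp
  show "laurent_form b (twist scale p e v) (twist scale p e w) = laurent_form b v w" for v w
  proof (induction v rule: laurent_induct)
    case (single i x)
    show ?case
    proof (induction w rule: laurent_induct)
      case (single j y)
      show ?case
        by (simp add: \<open>\<And>i x. twist scale p e (Poly_Mapping.single i x) = _ i x\<close> laurent_form_add_left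
            laurent_form_add_right laurent_form_single orth sum flip: single_add)
    qed (simp_all add: zero add laurent_form_add_right)
  qed (simp_all add: zero add laurent_form_add_left)
qed

lemma subspace_endo_image:
  assumes "\<phi> \<in> PPU scale b" "module.subspace (tinv_scale scale) U"
  shows "module.subspace (tinv_scale scale) (\<phi> ` U)"
proof -
  interpret M: module_hom "tinv_scale scale" "tinv_scale scale" \<phi>
    by (rule laurent_endo_tinv_hom[OF PU_endo[OF PPU_PU[OF assms(1)]]])
  show ?thesis using assms(2) by (rule M.subspace_image)
qed

lemma lattice_normalize:
  assumes "module.subspace (tinv_scale scale) U" "lat (- int N) \<subseteq> U" "U \<subseteq> lat 0"
  shows "\<exists>\<phi>\<in>PPU scale b. \<phi> ` U = lat 0"
  using assms
proof (induction N arbitrary: U)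
  case 0
  then show ?case by (intro bexI[of _ id] PPU_id) auto
next
  case (Suc N)
  interpret M: module "tinv_scale scale" by (rule module_tinv_scale)
  note U = Suc.prems
  define A where "A = (\<lambda>u. Poly_Mapping.lookup u 0) ` U"
  have "subspace A"
  proof (rule subspaceI)
    show "0 \<in> A" using M.subspace_0[OF U(1)] by (force simp: A_def)
    show "x + y \<in> A" if "x \<in> A" "y \<in> A" for x y
    proof -
      from that obtain u v where uv: "u \<in> U" "v \<in> U"
        "x = Poly_Mapping.lookup u 0" "y = Poly_Mapping.lookup v 0"
        by (auto simp: A_def)
      then have "x + y = Poly_Mapping.lookup (u + v) 0" by (simp add: lookup_add)
      then show ?thesis unfolding A_def using M.subspace_add[OF U(1) uv(1,2)] by blast
    qed
    show "scale c x \<in> A" if "x \<in> A" for c x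
    proof -
      from that obtain u where u: "u \<in> U" "x = Poly_Mapping.lookup u 0"
        by (auto simp: A_def)
      then have "scale c x = Poly_Mapping.lookup (laurent_scale scale (Poly_Mapping.single 0 c) u) 0"
        by (simp add: lookup_laurent_scale_single)
      then show ?thesis
        unfolding A_def using tinv_subspace_single_scale[OF U(1) u(1), of 0 c] by auto
    qed
  qed
  then obtain p where p: "orth_proj p" "\<And>x. p x \<in> A" "\<And>x. x \<in> A \<Longrightarrow> p x = x"
    using obtain_orth_proj by blast
  note p0 = orth_proj_0[OF p(1)]
  let ?\<phi> = "twist scale p 1"
  have \<phi>: "?\<phi> \<in> PPU scale b" using p(1) by (rule twist_PPU)
  have "?\<phi> ` U \<subseteq> lat 0"
  proof
    fix w assume "w \<in> ?\<phi> ` U"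
    then obtain u where u: "u \<in> U" "w = ?\<phi> u" by blast
    then have "u \<in> lat 0" "p (Poly_Mapping.lookup u 0) = Poly_Mapping.lookup u 0"
      using U(3) p(3) by (auto simp: A_def)
    then have "Poly_Mapping.lookup w i = 0" if "i > 0" for i
      using that by (cases "i = 1") (simp_all add: u(2) lookup_twist p0 lat_def)
    then show "w \<in> lat 0" by (simp add: lat_def)
  qed
  moreover have "lat (- int N) \<subseteq> ?\<phi> ` U"
  proof
    fix v :: "'v laurent" assume v: "v \<in> lat (- int N)"
    let ?w = "twist scale p (- 1) v"
    obtain u where u: "u \<in> U" "Poly_Mapping.lookup u 0 = p (Poly_Mapping.lookup v (- int N))"
      using p(2)[of "Poly_Mapping.lookup v (- int N)"] by (auto simp: A_def)
    let ?u = "laurent_scale scale (Poly_Mapping.single (- int N) 1) u"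
    have "?u \<in> U" using U(1) u(1) by (rule tinv_subspace_single_scale)
    have "u \<in> lat 0" using u(1) U(3) by blast
    have "Poly_Mapping.lookup (?w - ?u) i = 0" if "i > - int (Suc N)" for i
    proof (cases "i = - int N")
      case True
      then show ?thesis
        using v u(2) by (simp add: lookup_minus lookup_twist p0 lookup_laurent_scale_single lat_def)
    next
      case False
      with that have "i > - int N" by simp
      then show ?thesis
        using v \<open>u \<in> lat 0\<close>
        by (simp add: lookup_minus lookup_twist p0 lookup_laurent_scale_single lat_def)
    qed
    then have "?w - ?u \<in> U" using U(2) by (auto simp: lat_def)
    then have "?w - ?u + ?u \<in> U" using \<open>?u \<in> U\<close> by (rule M.subspace_add[OF U(1)])
    then have "?w \<in> U" by simp
    moreover have "v = ?\<phi> ?w" using twist_inverse[OF p(1), of "- 1" v] by simp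
    ultimately show "v \<in> ?\<phi> ` U" by blast
  qed
  ultimately obtain \<chi> where \<chi>: "\<chi> \<in> PPU scale b" "\<chi> ` ?\<phi> ` U = lat 0"
    using Suc.IH[OF subspace_endo_image[OF \<phi> U(1)]] by blast
  then show ?case
    using PPU_comp[OF \<chi>(1) \<phi>] by (intro bexI[of _ "\<chi> \<circ> ?\<phi>"]) (simp_all add: image_comp)
qed

lemma twist_0: "twist scale (\<lambda>_. 0) e = laurent_scale scale (t_power e)"
  by (rule ext, rule poly_mapping_eqI) (simp add: lookup_twist lookup_t_power_scale)

lemma orth_proj_const_0: "orth_proj (\<lambda>_. 0)"
  unfolding orth_proj_def by (intro conjI; (unfold_locales)?) simp_all

lemma tinv_lattice_normalize:
  assumes "U \<in> tinv_lattices scale"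
  shows "\<exists>\<phi>\<in>PPU scale b. \<phi> ` U = lat 0"
proof -
  interpret M: module "tinv_scale scale" by (rule module_tinv_scale)
  from assms obtain F m where U: "M.subspace U" "finite F" "U = M.span F"
    and "laurent_scale scale (t_power m) ` V_tinv \<subseteq> U"
    unfolding tinv_lattices_def by blast
  then have m: "lat m \<subseteq> U" by (simp add: V_tinv_eq_lat t_power_scale_lat)
  obtain n where "F \<subseteq> lat n" using finite_subset_lat[OF U(2)] by blast
  then have n: "U \<subseteq> lat n" unfolding U(3) by (rule M.span_minimal[OF _ tinv_subspace_lat])
  let ?s = "laurent_scale scale (t_power (- n))"
  have s: "?s \<in> PPU scale b"
    using twist_PPU[OF orth_proj_const_0, of "- n"] by (simp add: twist_0)
  have "?s ` U \<subseteq> lat 0"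
    using image_mono[OF n, of ?s] by (simp add: t_power_scale_lat)
  moreover have "lat (- int (nat (n - m))) \<subseteq> ?s ` U"
  proof -
    have "lat (- int (nat (n - m))) \<subseteq> lat (- n + m)" by (auto simp: lat_def)
    also have "\<dots> \<subseteq> ?s ` U"
      using image_mono[OF m, of ?s] by (simp add: t_power_scale_lat)
    finally show ?thesis .
  qed
  ultimately obtain \<chi> where \<chi>: "\<chi> \<in> PPU scale b" "\<chi> ` ?s ` U = lat 0"
    using lattice_normalize[OF subspace_endo_image[OF s U(1)]] by blast
  then show ?thesis
    using PPU_comp[OF \<chi>(1) s] by (intro bexI[of _ "\<chi> \<circ> ?s"]) (simp_all add: image_comp)
qed

lemma PPU_image_lattice:
  assumes "\<phi> \<in> PPU scale b"
  shows "\<phi> ` lat 0 \<in> tinv_lattices scale"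
proof -
  interpret h: module_hom "laurent_scale scale" "laurent_scale scale" "inv \<phi>"
    using PU_endo[OF PPU_PU[OF PPU_inv[OF assms]]] by (simp add: laurent_endo_def)
  interpret M: module_hom "tinv_scale scale" "tinv_scale scale" \<phi>
    by (rule laurent_endo_tinv_hom[OF PU_endo[OF PPU_PU[OF assms]]])
  interpret I: module_hom "tinv_scale scale" "tinv_scale scale" "inv \<phi>"
    by (rule laurent_endo_tinv_hom[OF PU_endo[OF PPU_PU[OF PPU_inv[OF assms]]]])
  let ?B = "Poly_Mapping.single 0 ` Basis"
  have "\<phi> ` lat 0 = M.m1.span (\<phi> ` ?B)"
    by (simp add: lat_0_eq_span M.span_image)
  moreover have "finite (\<phi> ` ?B)" by (simp add: finite_Basis)
  moreover have "M.m1.subspace (\<phi> ` lat 0)"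
    by (rule subspace_endo_image[OF assms tinv_subspace_lat])
  moreover have "\<exists>m. laurent_scale scale (t_power m) ` V_tinv \<subseteq> \<phi> ` lat 0"
  proof -
    obtain n where "inv \<phi> ` ?B \<subseteq> lat n"
      using finite_subset_lat[of "inv \<phi> ` ?B"] by (auto simp: finite_Basis)
    then have "M.m1.span (inv \<phi> ` ?B) \<subseteq> lat n"
      by (rule M.m1.span_minimal[OF _ tinv_subspace_lat])
    then have n: "inv \<phi> ` lat 0 \<subseteq> lat n"
      by (simp add: lat_0_eq_span I.span_image)
    have "laurent_scale scale (t_power (- n)) v \<in> \<phi> ` lat 0" if "v \<in> lat 0" for v
    proof -
      have "inv \<phi> (laurent_scale scale (t_power (- n)) v) \<in> laurent_scale scale (t_power (- n)) ` lat n"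
        using n that by (auto simp: h.scale)
      then have "inv \<phi> (laurent_scale scale (t_power (- n)) v) \<in> lat 0"
        by (simp add: t_power_scale_lat)
      then have "\<phi> (inv \<phi> (laurent_scale scale (t_power (- n)) v)) \<in> \<phi> ` lat 0" by (rule imageI)
      then show ?thesis using PPU_bij[OF assms] by (simp add: bij_is_surj surj_f_inv_f)
    qed
    then show ?thesis by (auto simp: V_tinv_eq_lat)
  qed
  ultimately show ?thesis unfolding tinv_lattices_def by blast
qed

lemma right_div_le_iff:
  assumes "\<phi> \<in> PPU scale b" "\<psi> \<in> PPU scale b"
  shows "right_div_le scale b \<phi> \<psi> \<longleftrightarrow> inv \<phi> ` lat 0 \<subseteq> inv \<psi> ` lat 0"
proof -
  have bij: "bij \<psi>" using assms(2) by (rule PPU_bij)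
  have "right_div_le scale b \<phi> \<psi> \<longleftrightarrow> \<psi> ` inv \<phi> ` lat 0 \<subseteq> lat 0"
    using PPU_neg_iff[OF PPU_comp[OF assms(2) PPU_inv[OF assms(1)]]]
    by (simp add: right_div_le_def image_comp)
  also have "\<dots> \<longleftrightarrow> \<psi> ` inv \<phi> ` lat 0 \<subseteq> \<psi> ` inv \<psi> ` lat 0"
    using bij by (simp add: image_f_inv_f bij_is_surj)
  also have "\<dots> \<longleftrightarrow> inv \<phi> ` lat 0 \<subseteq> inv \<psi> ` lat 0"
    using bij by (simp add: inj_image_subset_iff bij_is_inj)
  finally show ?thesis .
qed

lemma inj_on_inv_image_lat: "inj_on (\<lambda>\<phi>. inv \<phi> ` lat 0) (PPU scale b)"
proof (rule inj_onI)
  fix \<phi> \<psi> assume *: "\<phi> \<in> PPU scale b" "\<psi> \<in> PPU scale b" "inv \<phi> ` lat 0 = inv \<psi> ` lat 0"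
  have "(\<psi> \<circ> inv \<phi>) ` lat 0 = \<psi> ` inv \<psi> ` lat 0"
    using *(3) by (metis image_comp)
  also have "\<dots> = lat 0" using PPU_bij[OF *(2)] by (simp add: image_f_inv_f bij_is_surj)
  finally have "\<psi> \<circ> inv \<phi> = id"
    using * by (intro PPU_stabilizer_trivial PPU_comp PPU_inv)
  then have "\<psi> \<circ> (inv \<phi> \<circ> \<phi>) = \<phi>" by (metis comp_assoc comp_id id_comp)
  then show "\<phi> = \<psi>" using PPU_bij[OF *(1)] by (simp add: inv_o_cancel bij_is_inj)
qed

lemma inv_image_lat_surj:
  "(\<lambda>\<phi>. inv \<phi> ` lat 0) ` PPU scale b = tinv_lattices scale"
proof (intro equalityI subsetI)
  fix U assume "U \<in> tinv_lattices scale"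
  then obtain \<phi> where \<phi>: "\<phi> \<in> PPU scale b" "\<phi> ` U = lat 0"
    using tinv_lattice_normalize by blast
  have "inv \<phi> ` \<phi> ` U = U" using PPU_bij[OF \<phi>(1)] by (simp add: image_inv_f_f bij_is_inj)
  with \<phi> show "U \<in> (\<lambda>\<phi>. inv \<phi> ` lat 0) ` PPU scale b" by (metis image_eqI)
qed (auto intro: PPU_image_lattice PPU_inv)

lemma poset_iso_inv_image_lat:
  "poset_iso (PPU scale b) (right_div_le scale b) (tinv_lattices scale) (\<subseteq>)
    (\<lambda>\<phi>. inv \<phi> ` lat 0)"
proof -
  have "poset_on (PPU scale b) (right_div_le scale b)"
    unfolding poset_on_def
  proof (intro conjI)
    show "reflp_on (PPU scale b) (right_div_le scale b)"
      by (auto simp: reflp_on_def right_div_le_iff)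
    show "transp_on (PPU scale b) (right_div_le scale b)"
      by (rule transp_onI) (auto simp: right_div_le_iff)
    show "antisymp_on (PPU scale b) (right_div_le scale b)"
      by (rule antisymp_onI) (use inj_on_inv_image_lat in \<open>auto simp: right_div_le_iff inj_on_def\<close>)
  qed
  moreover have "poset_on (tinv_lattices scale) (\<subseteq>)"
    by (auto simp: poset_on_def reflp_on_def transp_on_def antisymp_on_def)
  ultimately show ?thesis
    using inj_on_inv_image_lat inv_image_lat_surj
    by (simp add: poset_iso_def bij_betw_def right_div_le_iff)
qed

end

theorem lemma11:
  fixes scale :: "'k::field \<Rightarrow> 'v::ab_group_add \<Rightarrow> 'v"
    and Basis :: "'v set"
    and b :: "'v \<Rightarrow> 'v \<Rightarrow> 'k"
  assumes "finite_dimensional_vector_space scale Basis"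
    and "bilinear_form scale b"
    and "symmetric_form b"
    and "anisotropic b"
  shows "poset_iso (PPU scale b) (right_div_le scale b) (tinv_lattices scale) (\<subseteq>)
    (\<lambda>\<phi>. inv \<phi> ` V_tinv)"
proof -
  interpret anisotropic_space scale Basis b
    using assms by (intro anisotropic_space.intro anisotropic_space_axioms.intro)
  show ?thesis using poset_iso_inv_image_lat by (simp add: V_tinv_eq_lat)
qed

end
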